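(* Let $n,k,s$ be positive integers with $s\ge 2$ and $n>ks$. Then $$ar(n,k,s)\le e_k(n,s-1)+\frac{(s-1)\binom{n}{k}}{\binom{n-(s-1)k}{k}}+1.$$
   Context: An $M$-coloring of $\binom{[n]}{k}$ is a partition of $\binom{[n]}{k}$ into $M$ non-empty families (color classes). A rainbow $s$-matching is a set of $s$ pairwise disjoint $k$-sets from pairwise distinct color classes. $ar(n,k,s)$ is the minimum $M$ such that every $M$-coloring of $\binom{[n]}{k}$ contains a rainbow $s$-matching. For a family $\mathcal F$, $\nu(\mathcal F)$ is the maximum number of pairwise disjoint members, and for a positive integer $t$, $e_k(n,t)=\max\{|\mathcal F|:\mathcal F\subset\binom{[n]}{k},\ \nu(\mathcal F)<t\}$. *)

theory Defs
  imports Complex_Main "HOL-Library.Ramsey" "HOL-Library.Disjoint_Sets"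
begin

text \<open>The $k$-subsets of $[n]$ are written \<open>nsets {1..n} k\<close>.\<close>

definition is_coloring :: "nat \<Rightarrow> nat \<Rightarrow> nat \<Rightarrow> nat set set set \<Rightarrow> bool" where
  "is_coloring n k M P \<longleftrightarrow> partition_on (nsets {1..n} k) P \<and> card P = M"

definition rainbow_matching :: "nat set set set \<Rightarrow> nat \<Rightarrow> nat set set \<Rightarrow> bool" where
  "rainbow_matching P s S \<longleftrightarrow>
     S \<subseteq> \<Union>P \<and> finite S \<and> card S = s \<and> disjoint S \<and>
     (\<forall>A\<in>S. \<forall>B\<in>S. A \<noteq> B \<longrightarrow> \<not> (\<exists>C\<in>P. A \<in> C \<and> B \<in> C))"

text \<open>The number of colors ranges over positive integers: there is no coloring with \<open>0\<close>
  classes when \<open>k \<le> n\<close>, so admitting \<open>M = 0\<close> would make the minimum vacuously \<open>0\<close>.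
  The minimum exists because there is no coloring with more than \<open>n choose k\<close> classes.\<close>

definition ar :: "nat \<Rightarrow> nat \<Rightarrow> nat \<Rightarrow> nat" where
  "ar n k s = (LEAST M. M > 0 \<and> (\<forall>P. is_coloring n k M P \<longrightarrow> (\<exists>S. rainbow_matching P s S)))"

text \<open>The matching number; meaningful for finite families.\<close>

definition matching_number :: "'a set set \<Rightarrow> nat" where
  "matching_number F = Max {card S | S. S \<subseteq> F \<and> disjoint S}"

definition ek :: "nat \<Rightarrow> nat \<Rightarrow> nat \<Rightarrow> nat" where
  "ek k n t = Max {card F | F. F \<subseteq> nsets {1..n} k \<and> matching_number F < t}"

end

theory Submission
  imports Defs
begin

text \<open>Write \<open>N = (n - (s - 1) k choose k)\<close> and suppose that a coloring has no rainbow \<open>s\<close>-matching.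
  The \<open>k\<close>-sets missing a rainbow \<open>(s - 1)\<close>-matching all carry one of its \<open>s - 1\<close> colors, so
  one of these colors is big: its class has at least \<open>N / (s - 1)\<close> members. Hence there is no
  rainbow \<open>(s - 1)\<close>-matching among the colors that are not big, and by choosing a member of each
  of their classes one sees that there are at most \<open>ek k n (s - 1)\<close> of them. Since the classes are
  disjoint, there are at most \<open>(s - 1) (n choose k) / N\<close> big colors.\<close>

lemma matching_of_card_matching_number:
  assumes "finite F"
  obtains S where "S \<subseteq> F" "disjoint S" "card S = matching_number F"
proof -
  have "finite {card S | S. S \<subseteq> F \<and> disjoint S}"
    by (rule finite_subset[of _ "card ` Pow F"]) (use assms in auto)
  moreover have "0 \<in> {card S | S. S \<subseteq> F \<and> disjoint S}"
    by (rule CollectI, rule exI[of _ "{}"]) (auto simp: disjoint_def)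
  ultimately have "matching_number F \<in> {card S | S. S \<subseteq> F \<and> disjoint S}"
    unfolding matching_number_def by (intro Max_in) blast+
  then show thesis using that by auto
qed

lemma card_le_ek:
  assumes "F \<subseteq> nsets {1..n} k" "matching_number F < t"
  shows "card F \<le> ek k n t"
  unfolding ek_def
proof (rule Max_ge)
  show "finite {card F | F. F \<subseteq> nsets {1..n} k \<and> matching_number F < t}"
    by (rule finite_subset[of _ "card ` Pow (nsets {1..n} k)"]) (auto simp: finite_imp_finite_nsets)
qed (use assms in blast)

text \<open>By maximality such a family has matching number at least \<open>t\<close>, and any
  subset of a matching is again a matching, so the size can be cut down to exactly
  \<open>t\<close>.\<close>

lemma matching_if_ek_less_card:
  assumes "F \<subseteq> nsets {1..n} k" "ek k n t < card F"
  obtains S where "S \<subseteq> F" "disjoint S" "card S = t"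
proof -
  have "finite F"
    using assms(1) finite_imp_finite_nsets[of "{1..n}" k] finite_subset by blast
  then obtain S where S: "S \<subseteq> F" "disjoint S" "card S = matching_number F"
    by (rule matching_of_card_matching_number)
  have "t \<le> card S"
    using card_le_ek[OF assms(1)] assms(2) S(3) by (metis not_le)
  then obtain S' where "S' \<subseteq> S" "card S' = t"
    by (rule obtain_subset_with_card_n) blast
  moreover from this have "disjoint S'" using S(2) by (auto simp: disjoint_def)
  ultimately show thesis using that[of S'] S(1) by blast
qed

lemma card_Union_matching:
  assumes "S \<subseteq> nsets A k" "disjoint S"
  shows "card (\<Union>S) = card S * k"
proof -
  have "card (\<Union>S) = (\<Sum>T\<in>S. card T)"
    using assms by (intro card_Union_disjoint) (auto simp: nsets_def disjoint_def pairwise_def disjnt_def)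
  also have "\<dots> = (\<Sum>T\<in>S. k)"
    using assms(1) by (intro sum.cong) (auto simp: nsets_def)
  finally show ?thesis by simp
qed

lemma partition_on_eq_class:
  assumes "partition_on X P" "C \<in> P" "D \<in> P" "a \<in> C" "a \<in> D"
  shows "C = D"
  using disjointD[OF partition_onD2[OF assms(1)], of C D] assms(2-) by blast

text \<open>The map \<open>r\<close> picks one representative per class, so distinct members of
  \<open>S\<close> have distinct colors. The color \<open>C\<close> of \<open>T\<close> is new as
  well: a member of \<open>S\<close> lying in \<open>C\<close> would have to be
  \<open>r C\<close>.\<close>

lemma rainbow_matching_transversal_mono:
  assumes part: "partition_on X P"
    and r: "\<And>C. C \<in> P \<Longrightarrow> r C \<in> C"
    and S: "S \<subseteq> r ` Q" "Q \<subseteq> P" "disjoint S" "finite S"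
    and T: "T \<in> C" "C \<in> P" "r C \<notin> S" "T \<inter> \<Union>S = {}" "T \<noteq> {}"
  shows "rainbow_matching P (Suc (card S)) (insert T S)"
proof -
  have eq: "C1 = C2" if "C1 \<in> P" "C2 \<in> P" "A \<in> C1" "A \<in> C2" for A C1 C2
    using partition_on_eq_class[OF part] that by blast
  have color: "D \<in> P \<and> r D = A \<and> A \<in> D" if "A \<in> S" "A \<in> D" "D \<in> P" for A D
  proof -
    from \<open>A \<in> S\<close> S(1,2) obtain D' where D': "D' \<in> P" "A = r D'" by blast
    with that r have "D = D'" by (intro eq[of _ _ A]) auto
    with D' that show ?thesis by simp
  qed
  have "T \<notin> S" using T by auto
  then show ?thesis
    unfolding rainbow_matching_def
  proof (intro conjI ballI impI)
    show "insert T S \<subseteq> \<Union>P" using S T r by blast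
    show "disjoint (insert T S)" using S(3) T(4) by (auto simp: disjoint_def)
    fix A B assume AB: "A \<in> insert T S" "B \<in> insert T S" "A \<noteq> B"
    show "\<not> (\<exists>D\<in>P. A \<in> D \<and> B \<in> D)"
    proof
      assume "\<exists>D\<in>P. A \<in> D \<and> B \<in> D"
      then obtain D where D: "D \<in> P" "A \<in> D" "B \<in> D" by blast
      have "D = C" if "T \<in> D" using eq[OF \<open>D \<in> P\<close> \<open>C \<in> P\<close> that \<open>T \<in> C\<close>] .
      then show False using AB D \<open>r C \<notin> S\<close> color[of A D] color[of B D] by auto
    qed
  qed (use S in auto)
qed

text \<open>The threshold \<open>N / t\<close> on the class size, multiplied out to stay within the
  natural numbers.\<close>

definition big_classes :: "nat \<Rightarrow> nat \<Rightarrow> 'a set set \<Rightarrow> 'a set set" where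
  "big_classes t N P = {C \<in> P. N \<le> t * card C}"

lemma card_big_classes_le:
  assumes "finite X" "partition_on X P"
  shows "card (big_classes t N P) * N \<le> t * card X"
proof -
  have "finite P" using assms by (rule finite_elements)
  have "card (big_classes t N P) * N = (\<Sum>C\<in>big_classes t N P. N)" by simp
  also have "\<dots> \<le> (\<Sum>C\<in>big_classes t N P. t * card C)"
    by (rule sum_mono) (simp add: big_classes_def)
  also have "\<dots> \<le> (\<Sum>C\<in>P. t * card C)"
    by (rule sum_mono2) (auto simp: big_classes_def \<open>finite P\<close>)
  also have "\<dots> = t * card (\<Union>P)"
    using assms finite_elements[OF assms]
    by (subst card_Union_disjoint)
      (auto simp: partition_on_def disjoint_def pairwise_def disjnt_def sum_distrib_left
        intro: finite_subset)
  also have "\<Union>P = X" using assms(2) by (auto simp: partition_on_def)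
  finally show ?thesis .
qed

lemma rainbow_matching_if_many_small_classes:
  assumes "k > 0" "t > 0"
    and part: "partition_on (nsets {1..n} k) P"
    and many: "ek k n t < card (P - big_classes t ((n - t * k) choose k) P)"
  shows "\<exists>S. rainbow_matching P (Suc t) S"
proof (rule ccontr)
  assume none: "\<nexists>S. rainbow_matching P (Suc t) S"
  define N where "N = (n - t * k) choose k"
  define R where "R = P - big_classes t N P"
  define r :: "nat set set \<Rightarrow> nat set" where "r C = (SOME A. A \<in> C)" for C
  have r: "r C \<in> C" if "C \<in> P" for C
    unfolding r_def using part that by (metis partition_onD3 some_in_eq)
  have "inj_on r R"
    using r partition_on_eq_class[OF part] unfolding R_def inj_on_def by (metis DiffD1)
  then have "ek k n t < card (r ` R)"
    using many by (simp add: card_image R_def N_def)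
  moreover have rR: "r ` R \<subseteq> nsets {1..n} k"
    using r part by (auto simp: R_def partition_on_def)
  ultimately obtain S where S: "S \<subseteq> r ` R" "disjoint S" "card S = t"
    by (elim matching_if_ek_less_card[rotated])
  \<comment> \<open>Infinite sets have \<open>card\<close> 0, so a positive cardinality gives
    finiteness.\<close>
  have "finite S" using S(3) \<open>t > 0\<close> by (simp add: card_ge_0_finite)
  define Q where "Q = {C \<in> R. r C \<in> S}"
  have "r ` Q = S" using S(1) by (auto simp: Q_def)
  moreover have "inj_on r Q"
    using \<open>inj_on r R\<close> by (rule inj_on_subset) (auto simp: Q_def)
  ultimately have "card Q = t" using card_image S(3) by fastforce
  have "finite Q" using \<open>card Q = t\<close> \<open>t > 0\<close> by (simp add: card_ge_0_finite)
  \<comment> \<open>\<open>Q\<close> consists of the colors of \<open>S\<close>. A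
    \<open>k\<close>-set that misses \<open>S\<close> and has a color outside \<open>Q\<close> would
    extend \<open>S\<close> to a rainbow matching of size \<open>Suc t\<close>.\<close>
  have sub: "nsets ({1..n} - \<Union>S) k \<subseteq> \<Union>Q"
  proof
    fix T assume T: "T \<in> nsets ({1..n} - \<Union>S) k"
    then have "T \<in> \<Union>P" using part by (auto simp: partition_on_def nsets_def)
    then obtain C where C: "C \<in> P" "T \<in> C" by blast
    have "T \<inter> \<Union>S = {}" "T \<noteq> {}" using T \<open>k > 0\<close> by (auto simp: nsets_def)
    then have "r C \<in> S"
      using rainbow_matching_transversal_mono[where r = r and S = S and Q = R, OF part r]
        none C S \<open>finite S\<close> by (auto simp: R_def)
    \<comment> \<open>A priori \<open>C\<close> might be big. But \<open>r C\<close> also represents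
      a class \<open>D\<close> of \<open>R\<close>, and classes sharing an element coincide.\<close>
    then obtain D where "D \<in> R" "r C = r D" using S(1) by blast
    then have "C = D"
      using r C partition_on_eq_class[OF part] unfolding R_def by (metis DiffD1)
    then show "T \<in> \<Union>Q" using C \<open>D \<in> R\<close> \<open>r C \<in> S\<close> by (auto simp: Q_def)
  qed
  have "card (\<Union>S) = t * k"
    using card_Union_matching S rR by (metis subset_trans)
  moreover have "\<Union>S \<subseteq> {1..n}" using S(1) rR by (auto simp: nsets_def)
  ultimately have "card (nsets ({1..n} - \<Union>S) k) = N"
    by (simp add: N_def card_Diff_subset finite_subset)
  moreover have "finite (\<Union>Q)"
  proof (rule finite_subset)
    show "\<Union>Q \<subseteq> nsets {1..n} k" using partition_onD1[OF part] by (auto simp: Q_def R_def)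
  qed (simp add: finite_imp_finite_nsets)
  ultimately have "N \<le> card (\<Union>Q)" using card_mono[OF _ sub] by simp
  also have "\<dots> \<le> (\<Sum>C\<in>Q. card C)" by (rule card_Union_le_sum_card)
  finally have "t * N \<le> (\<Sum>C\<in>Q. t * card C)" by (simp flip: sum_distrib_left)
  \<comment> \<open>Every class in \<open>Q\<close> is small, that is \<open>t * card C < N\<close>;
    as \<open>Q\<close> is nonempty, the sum inherits strictness, which contradicts the lower bound
    \<open>t * N\<close>.\<close>
  also have "\<dots> < (\<Sum>C\<in>Q. N)"
  proof (rule sum_strict_mono)
    show "Q \<noteq> {}" using \<open>card Q = t\<close> \<open>t > 0\<close> by auto
  qed (use \<open>finite Q\<close> in \<open>auto simp: Q_def R_def big_classes_def\<close>)
  also have "\<dots> = t * N" using \<open>card Q = t\<close> by simp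
  finally show False by simp
qed

theorem theorem5:
  fixes n k s :: nat
  assumes "n > 0" and "k > 0" and "s \<ge> 2" and "n > k * s"
  shows "real (ar n k s) \<le>
    real (ek k n (s - 1)) + real (s - 1) * real (n choose k) / real ((n - (s - 1) * k) choose k) + 1"
proof -
  define t where "t = s - 1"
  define N where "N = (n - t * k) choose k"
  define x where "x = real t * real (n choose k) / real N"
  \<comment> \<open>The least integer strictly above \<open>ek k n t + x\<close>: strictness leaves
    more than \<open>ek k n t\<close> small classes, and exceeding the sum by at most 1 gives the
    final bound.\<close>
  define M where "M = Suc (nat \<lfloor>real (ek k n t) + x\<rfloor>)"
  have t: "t > 0" "s = Suc t" using \<open>s \<ge> 2\<close> by (auto simp: t_def)
  \<comment> \<open>This makes \<open>N\<close> positive, so the quotient \<open>x\<close> is a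
    genuine one and not the default value of division by 0.\<close>
  have "k \<le> n - t * k" using \<open>n > k * s\<close> t by (simp add: algebra_simps)
  then have "N > 0" by (simp add: N_def)
  have "x \<ge> 0" by (simp add: x_def)
  have M: "real (ek k n t) + x < real M" "real M \<le> real (ek k n t) + x + 1"
    using \<open>x \<ge> 0\<close> unfolding M_def by linarith+
  have "\<exists>S. rainbow_matching P s S" if col: "is_coloring n k M P" for P
  proof -
    have part: "partition_on (nsets {1..n} k) P" and "card P = M"
      using col by (auto simp: is_coloring_def)
    have fin: "finite (nsets {1..n} k)" by (simp add: finite_imp_finite_nsets)
    have "card (big_classes t N P) * N \<le> t * (n choose k)"
      using card_big_classes_le[OF fin part, of t N] by simp
    then have "real (card (big_classes t N P)) \<le> x"
      using \<open>N > 0\<close> by (simp add: x_def pos_le_divide_eq flip: of_nat_mult)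
    moreover have "card (P - big_classes t N P) = M - card (big_classes t N P)"
      using finite_elements[OF fin part] \<open>card P = M\<close>
      by (subst card_Diff_subset) (auto simp: big_classes_def intro: finite_subset)
    ultimately have "ek k n t < card (P - big_classes t N P)"
      using M(1) by linarith
    then show ?thesis
      unfolding \<open>s = Suc t\<close> N_def
      by (rule rainbow_matching_if_many_small_classes[OF \<open>k > 0\<close> \<open>t > 0\<close> part])
  qed
  \<comment> \<open>Since \<open>ar\<close> is a least element, it suffices that \<open>M\<close>
    itself qualifies; its positivity comes from the \<open>Suc\<close>.\<close>
  then have "ar n k s \<le> M"
    unfolding ar_def by (intro Least_le) (auto simp: M_def)
  then show ?thesis
    using M(2) by (simp add: x_def N_def t_def)
qed

end
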